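(* Let $\ell^{n}=\{M,H\}$ be a Cartan space with $(\alpha,\beta)$-metric whose fundamental function is $H(\alpha,\beta)=\dfrac{\beta^{3}}{\beta-\alpha}$, considered on the region $U\subset T^{*}M\setminus\{0\}$. Then the invariants $r_{-1},r_{-2},r_{-3},r_{-4}$ of its Cartan tensor $C^{ijk}$ are $$r_{-1}=\frac{-3\alpha^{3}}{(\beta-\alpha)^{4}},\qquad r_{-2}=\frac{3\alpha\beta}{(\beta-\alpha)^{4}},$$ $$r_{-3}=\frac{4\alpha\beta^{3}-\beta^{4}-9\alpha^{2}\beta^{2}}{2\alpha^{3}(\beta-\alpha)^{4}},\qquad r_{-4}=\frac{15\alpha^{2}\beta^{3}+3\beta^{5}-12\alpha\beta^{4}}{2\alpha^{5}(\beta-\alpha)^{4}}.$$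
   Context: $M$ is an $n$-dimensional smooth manifold, $(x,y)=(x^i,y_i)$ are the canonical coordinates on $T^{*}M$, and summation over repeated indices is understood. $a^{ij}(x)$ is a (contravariant) Riemannian metric on $M$, $b^{i}(x)$ a vector field on $M$, $\alpha(x,y)=\sqrt{a^{ij}(x)y_iy_j}$, $\beta(x,y)=b^{i}(x)y_i$, and $Y^{i}=a^{ij}y_j$. $U$ denotes the region of $T^{*}M\setminus\{0\}$ (zero section removed) where $\beta>0$ and $\alpha<\beta$. A Cartan space $\ell^{n}=\{M,H(x,y)\}$ is given by a fundamental function $H(x,y)$ positively homogeneous of degree $2$ in $y$ whose fundamental tensor $g^{ij}=\frac12\frac{\partial^2 H}{\partial y_i\partial y_j}$ is nondegenerate. It is a Cartan space with $(\alpha,\beta)$-metric if $H(x,y)=H(\alpha(x,y),\beta(x,y))$ is a function of $\alpha$ and $\beta$ only. Its Cartan tensor is $C^{ijk}=-\frac12\frac{\partial g^{ij}}{\partial y_k}$. Subscripts on $H$ denote partial derivatives of $H(\alpha,\beta)$. The invariants $r_{-1},\dots,r_{-4}$ (the coefficients of $b^ib^jb^k$, $b^ib^jY^k$, $b^iY^jY^k$, $Y^iY^jY^k$, up to cyclic symmetrization, in $-2C^{ijk}$) are $$r_{-1}=\tfrac12H_{\beta\beta\beta},\quad r_{-2}=\tfrac{1}{2\alpha}H_{\alpha\beta\beta},\quad r_{-3}=\tfrac{1}{2\alpha^{2}}\left(H_{\alpha\alpha\beta}-\alpha^{-1}H_{\alpha\beta}\right),\quad r_{-4}=\tfrac{1}{2\alpha^{3}}\left(H_{\alpha\alpha\alpha}-3\alpha^{-1}H_{\alpha\alpha}+3\alpha^{-2}H_{\alpha}\right).$$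 *)

theory Defs
  imports "HOL-Analysis.Analysis"
begin

section \<open>Smooth maps and manifolds\<close>

text \<open>Used for open \<open>S\<close> only: \<open>f\<close> is \<open>k\<close> times continuously differentiable on \<open>S\<close>.\<close>

primrec Ck_on :: "nat \<Rightarrow> ('a::euclidean_space \<Rightarrow> 'b::real_normed_vector) \<Rightarrow> 'a set \<Rightarrow> bool" where
  "Ck_on 0 f S \<longleftrightarrow> continuous_on S f"
| "Ck_on (Suc k) f S \<longleftrightarrow>
     (\<forall>x\<in>S. f differentiable (at x)) \<and> (\<forall>v. Ck_on k (\<lambda>x. frechet_derivative f (at x) v) S)"

definition smooth_on :: "('a::euclidean_space \<Rightarrow> 'b::real_normed_vector) \<Rightarrow> 'a set \<Rightarrow> bool" where
  "smooth_on f S \<longleftrightarrow> (\<forall>k. Ck_on k f S)"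

text \<open>A chart is its domain together with its coordinate map; the manifold is the whole type
  \<open>'m\<close> and its dimension is \<open>CARD('n)\<close>.\<close>

type_synonym ('m, 'n) chart = "'m set \<times> ('m \<Rightarrow> real ^ 'n)"

abbreviation chart_inv :: "('m, 'n) chart \<Rightarrow> real ^ 'n \<Rightarrow> 'm" where
  "chart_inv c \<equiv> inv_into (fst c) (snd c)"

definition smooth_manifold ::
    "('m::{t2_space, second_countable_topology}, 'n::finite) chart set \<Rightarrow> bool" where
  "smooth_manifold A \<longleftrightarrow>
     (\<Union>c\<in>A. fst c) = UNIV \<and>
     (\<forall>c\<in>A. open (fst c) \<and> open (snd c ` fst c) \<and>
        homeomorphism (fst c) (snd c ` fst c) (snd c) (chart_inv c)) \<and>
     (\<forall>c\<in>A. \<forall>c'\<in>A. smooth_on (snd c' \<circ> chart_inv c) (snd c ` (fst c \<inter> fst c')))"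

text \<open>The entry in row \<open>i\<close>, column \<open>j\<close> is \<open>\<partial>x'\<^sup>i / \<partial>x\<^sup>j\<close>, where \<open>x\<close> are the coordinates of \<open>c\<close>
  and \<open>x'\<close> those of \<open>c'\<close>.\<close>

definition jacobian ::
    "('m, 'n::finite) chart \<Rightarrow> ('m, 'n) chart \<Rightarrow> 'm \<Rightarrow> real ^ 'n ^ 'n" where
  "jacobian c c' p = matrix (frechet_derivative (snd c' \<circ> chart_inv c) (at (snd c p)))"

text \<open>Tensor fields are families of components, one for each chart, related by the tensorial
  transformation laws.\<close>

definition contravariant_riemannian_metric ::
    "('m, 'n::finite) chart set \<Rightarrow> (('m, 'n) chart \<Rightarrow> 'm \<Rightarrow> real ^ 'n ^ 'n) \<Rightarrow> bool" where
  "contravariant_riemannian_metric A a \<longleftrightarrow>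
     (\<forall>c\<in>A. smooth_on (a c \<circ> chart_inv c) (snd c ` fst c)) \<and>
     (\<forall>c\<in>A. \<forall>p\<in>fst c. transpose (a c p) = a c p \<and> (\<forall>y. y \<noteq> 0 \<longrightarrow> 0 < y \<bullet> (a c p *v y))) \<and>
     (\<forall>c\<in>A. \<forall>c'\<in>A. \<forall>p\<in>fst c \<inter> fst c'.
        a c' p = jacobian c c' p ** a c p ** transpose (jacobian c c' p))"

definition vector_field ::
    "('m, 'n::finite) chart set \<Rightarrow> (('m, 'n) chart \<Rightarrow> 'm \<Rightarrow> real ^ 'n) \<Rightarrow> bool" where
  "vector_field A b \<longleftrightarrow>
     (\<forall>c\<in>A. smooth_on (b c \<circ> chart_inv c) (snd c ` fst c)) \<and>
     (\<forall>c\<in>A. \<forall>c'\<in>A. \<forall>p\<in>fst c \<inter> fst c'. b c' p = jacobian c c' p *v b c p)"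


section \<open>Cartan spaces\<close>

definition pderiv_at :: "'n::finite \<Rightarrow> (real ^ 'n \<Rightarrow> real) \<Rightarrow> real ^ 'n \<Rightarrow> real" where
  "pderiv_at i f y = deriv (\<lambda>t. f (y + t *\<^sub>R axis i 1)) 0"

text \<open>In the next two definitions \<open>f\<close> is the fundamental function on the fibre over a fixed point,
  written in the canonical fibre coordinates \<open>y\<^sub>i\<close>.\<close>

definition fundamental_tensor :: "(real ^ 'n::finite \<Rightarrow> real) \<Rightarrow> real ^ 'n \<Rightarrow> real ^ 'n ^ 'n" where
  "fundamental_tensor f y = (\<chi> i j. 1/2 * pderiv_at i (pderiv_at j f) y)"

definition cartan_tensor :: "(real ^ 'n::finite \<Rightarrow> real) \<Rightarrow> real ^ 'n \<Rightarrow> 'n \<Rightarrow> 'n \<Rightarrow> 'n \<Rightarrow> real" where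
  "cartan_tensor f y i j k = - 1/2 * pderiv_at k (\<lambda>z. fundamental_tensor f z $ i $ j) y"

text \<open>The canonical coordinates over a chart \<open>c\<close> identify a covector at \<open>p\<close> with its components
  \<open>y\<close>. A region of the cotangent bundle is given by the sets \<open>U c\<close> of pairs \<open>(p, y)\<close>, and a function
  on it by its expressions \<open>F c p y\<close>; components \<open>y'\<close> over \<open>c'\<close> and \<open>y\<close> over \<open>c\<close> describe the same
  covector iff \<open>y\<^sub>j = (\<partial>x'\<^sup>i / \<partial>x\<^sup>j) y'\<^sub>i\<close>.\<close>

definition cartan_space ::
    "('m, 'n::finite) chart set \<Rightarrow> (('m, 'n) chart \<Rightarrow> ('m \<times> (real ^ 'n)) set) \<Rightarrow>
     (('m, 'n) chart \<Rightarrow> 'm \<Rightarrow> real ^ 'n \<Rightarrow> real) \<Rightarrow> bool" where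
  "cartan_space A U F \<longleftrightarrow>
     (\<forall>c\<in>A. \<forall>c'\<in>A. \<forall>p\<in>fst c \<inter> fst c'. \<forall>y'. (p, y') \<in> U c' \<longrightarrow>
        F c p (transpose (jacobian c c' p) *v y') = F c' p y') \<and>
     (\<forall>c\<in>A. smooth_on (\<lambda>(x, y). F c (chart_inv c x) y)
        {(x, y). x \<in> snd c ` fst c \<and> (chart_inv c x, y) \<in> U c}) \<and>
     (\<forall>c\<in>A. \<forall>(p, y)\<in>U c. \<forall>l>0. F c p (l *\<^sub>R y) = l\<^sup>2 * F c p y) \<and>
     (\<forall>c\<in>A. \<forall>(p, y)\<in>U c. det (fundamental_tensor (F c p) y) \<noteq> 0)"


section \<open>Cartan spaces with \<open>(\<alpha>, \<beta>)\<close>-metric\<close>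

text \<open>Here \<open>g\<close> and \<open>v\<close> are the components of the metric and of the vector field at a point.\<close>

definition alpha :: "real ^ 'n ^ 'n \<Rightarrow> real ^ 'n::finite \<Rightarrow> real" where
  "alpha g y = sqrt (\<Sum>i\<in>UNIV. \<Sum>j\<in>UNIV. g $ i $ j * y $ i * y $ j)"

definition beta :: "real ^ 'n \<Rightarrow> real ^ 'n::finite \<Rightarrow> real" where
  "beta v y = (\<Sum>i\<in>UNIV. v $ i * y $ i)"

definition region_U ::
    "(('m, 'n::finite) chart \<Rightarrow> 'm \<Rightarrow> real ^ 'n ^ 'n) \<Rightarrow> (('m, 'n) chart \<Rightarrow> 'm \<Rightarrow> real ^ 'n) \<Rightarrow>
     ('m, 'n) chart \<Rightarrow> ('m \<times> (real ^ 'n)) set" where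
  "region_U a b c = {(p, y). p \<in> fst c \<and> y \<noteq> 0 \<and>
     0 < beta (b c p) y \<and> alpha (a c p) y < beta (b c p) y}"

definition alpha_beta_cartan_space ::
    "('m, 'n::finite) chart set \<Rightarrow> (('m, 'n) chart \<Rightarrow> ('m \<times> (real ^ 'n)) set) \<Rightarrow>
     (('m, 'n) chart \<Rightarrow> 'm \<Rightarrow> real ^ 'n ^ 'n) \<Rightarrow> (('m, 'n) chart \<Rightarrow> 'm \<Rightarrow> real ^ 'n) \<Rightarrow>
     (('m, 'n) chart \<Rightarrow> 'm \<Rightarrow> real ^ 'n \<Rightarrow> real) \<Rightarrow> (real \<Rightarrow> real \<Rightarrow> real) \<Rightarrow> bool" where
  "alpha_beta_cartan_space A U a b F H \<longleftrightarrow> cartan_space A U F \<and>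
     (\<forall>c\<in>A. \<forall>(p, y)\<in>U c. F c p y = H (alpha (a c p) y) (beta (b c p) y))"

text \<open>Partial derivatives of \<open>H(\<alpha>, \<beta>)\<close>; \<open>H\<^sub>\<alpha>\<^sub>\<beta>\<close> is \<open>d_beta (d_alpha H)\<close>, and so on.\<close>

definition d_alpha :: "(real \<Rightarrow> real \<Rightarrow> real) \<Rightarrow> real \<Rightarrow> real \<Rightarrow> real" where
  "d_alpha H s t = deriv (\<lambda>x. H x t) s"

definition d_beta :: "(real \<Rightarrow> real \<Rightarrow> real) \<Rightarrow> real \<Rightarrow> real \<Rightarrow> real" where
  "d_beta H s t = deriv (\<lambda>x. H s x) t"

definition r_m1 :: "(real \<Rightarrow> real \<Rightarrow> real) \<Rightarrow> real \<Rightarrow> real \<Rightarrow> real" where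
  "r_m1 H s t = 1/2 * d_beta (d_beta (d_beta H)) s t"

definition r_m2 :: "(real \<Rightarrow> real \<Rightarrow> real) \<Rightarrow> real \<Rightarrow> real \<Rightarrow> real" where
  "r_m2 H s t = 1 / (2 * s) * d_beta (d_beta (d_alpha H)) s t"

definition r_m3 :: "(real \<Rightarrow> real \<Rightarrow> real) \<Rightarrow> real \<Rightarrow> real \<Rightarrow> real" where
  "r_m3 H s t = 1 / (2 * s^2) *
     (d_beta (d_alpha (d_alpha H)) s t - 1 / s * d_beta (d_alpha H) s t)"

definition r_m4 :: "(real \<Rightarrow> real \<Rightarrow> real) \<Rightarrow> real \<Rightarrow> real \<Rightarrow> real" where
  "r_m4 H s t = 1 / (2 * s^3) *
     (d_alpha (d_alpha (d_alpha H)) s t - 3 / s * d_alpha (d_alpha H) s t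
       + 3 / s^2 * d_alpha H s t)"


section \<open>The invariants are coefficients of the Cartan tensor\<close>

text \<open>Lemma \<open>cartan_tensor_coefficients\<close> below expands \<open>- 2 C\<^sup>i\<^sup>j\<^sup>k\<close> for an arbitrary smooth
  \<open>H(\<alpha>, \<beta>)\<close>: \<open>r_m1\<close>, \<open>r_m2\<close>, \<open>r_m3\<close>, \<open>r_m4\<close> are its coefficients at \<open>bbb\<close>, \<open>bbY\<close>, \<open>bYY\<close>, \<open>YYY\<close>.
  The remaining terms contain the metric \<open>a\<^sup>i\<^sup>j\<close>.\<close>

lemma Ck_on_cong:
  assumes "open S" "\<And>x. x \<in> S \<Longrightarrow> f x = g x" "Ck_on k f S"
  shows "Ck_on k g S"
  using assms(2,3)
proof (induction k arbitrary: f g)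
  case 0
  then show ?case by (simp cong: continuous_on_cong)
next
  case (Suc k)
  have D: "(g has_derivative D) (at x) \<longleftrightarrow> (f has_derivative D) (at x)" if "x \<in> S" for x D
    using has_derivative_transform_within_open[OF _ assms(1) that, of f D UNIV g]
      has_derivative_transform_within_open[OF _ assms(1) that, of g D UNIV f] Suc.prems(1) by auto
  have fd: "frechet_derivative f (at x) = frechet_derivative g (at x)" if "x \<in> S" for x
    unfolding frechet_derivative_def using D[OF that] by simp
  have diff: "g differentiable (at x)" if "x \<in> S" for x
    using Suc.prems(2) D[OF that] that by (auto simp: differentiable_def)
  have "Ck_on k (\<lambda>x. frechet_derivative g (at x) v) S" for v
    by (rule Suc.IH[of "\<lambda>x. frechet_derivative f (at x) v"]) (use fd Suc.prems(2) in auto)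
  with diff show ?case by simp
qed

lemma smooth_two_variables:
  fixes h :: "real \<Rightarrow> real \<Rightarrow> real"
  assumes S: "open S" and sm: "smooth_on (\<lambda>(s, t). h s t) S"
  shows "(s, t) \<in> S \<Longrightarrow> ((\<lambda>(s, t). h s t) has_derivative
            (\<lambda>(u, v). u * d_alpha h s t + v * d_beta h s t)) (at (s, t))"
    and "smooth_on (\<lambda>(s, t). d_alpha h s t) S"
    and "smooth_on (\<lambda>(s, t). d_beta h s t) S"
proof -
  let ?h = "\<lambda>(s, t). h s t"
  have fd: "(?h has_derivative frechet_derivative ?h (at z)) (at z)" if "z \<in> S" for z
    using sm that unfolding smooth_on_def by (metis Ck_on.simps(2) frechet_derivative_works)
  have A: "d_alpha h s t = frechet_derivative ?h (at (s, t)) (1, 0)" if "(s, t) \<in> S" for s t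
  proof -
    have "((\<lambda>x. (x, t)) has_derivative (\<lambda>u. (u, 0))) (at s)"
      by (auto intro!: derivative_eq_intros)
    from has_derivative_compose[OF this fd[OF that]]
    have "((\<lambda>x. h x t) has_derivative (\<lambda>u. frechet_derivative ?h (at (s, t)) (u, 0))) (at s)"
      by simp
    moreover have "(\<lambda>u. frechet_derivative ?h (at (s, t)) (u, 0)) =
        (*) (frechet_derivative ?h (at (s, t)) (1, 0))"
    proof
      fix u :: real
      show "frechet_derivative ?h (at (s, t)) (u, 0) = frechet_derivative ?h (at (s, t)) (1, 0) * u"
        using linear_scale[OF has_derivative_linear[OF fd[OF that]], of u "(1, 0)"]
        by (simp add: mult.commute)
    qed
    ultimately have "((\<lambda>x. h x t) has_real_derivative frechet_derivative ?h (at (s, t)) (1, 0)) (at s)"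
      unfolding has_field_derivative_def by (simp only:)
    then show ?thesis unfolding d_alpha_def by (rule DERIV_imp_deriv)
  qed
  have B: "d_beta h s t = frechet_derivative ?h (at (s, t)) (0, 1)" if "(s, t) \<in> S" for s t
  proof -
    have "((\<lambda>x. (s, x)) has_derivative (\<lambda>u. (0, u))) (at t)"
      by (auto intro!: derivative_eq_intros)
    from has_derivative_compose[OF this fd[OF that]]
    have "((\<lambda>x. h s x) has_derivative (\<lambda>u. frechet_derivative ?h (at (s, t)) (0, u))) (at t)"
      by simp
    moreover have "(\<lambda>u. frechet_derivative ?h (at (s, t)) (0, u)) =
        (*) (frechet_derivative ?h (at (s, t)) (0, 1))"
    proof
      fix u :: real
      show "frechet_derivative ?h (at (s, t)) (0, u) = frechet_derivative ?h (at (s, t)) (0, 1) * u"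
        using linear_scale[OF has_derivative_linear[OF fd[OF that]], of u "(0, 1)"]
        by (simp add: mult.commute)
    qed
    ultimately have "((\<lambda>x. h s x) has_real_derivative frechet_derivative ?h (at (s, t)) (0, 1)) (at t)"
      unfolding has_field_derivative_def by (simp only:)
    then show ?thesis unfolding d_beta_def by (rule DERIV_imp_deriv)
  qed
  show "(?h has_derivative (\<lambda>(u, v). u * d_alpha h s t + v * d_beta h s t)) (at (s, t))"
    if st: "(s, t) \<in> S"
  proof -
    have l: "linear (frechet_derivative ?h (at (s, t)))"
      by (rule has_derivative_linear[OF fd[OF st]])
    have "frechet_derivative ?h (at (s, t)) (u, v) = u * d_alpha h s t + v * d_beta h s t" for u v
      using linear_add[OF l, of "u *\<^sub>R (1, 0)" "v *\<^sub>R (0, 1)"]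
        linear_scale[OF l, of u "(1, 0)"] linear_scale[OF l, of v "(0, 1)"] A[OF st] B[OF st]
      by simp
    then have "frechet_derivative ?h (at (s, t)) = (\<lambda>(u, v). u * d_alpha h s t + v * d_beta h s t)"
      by auto
    with fd[OF st] show ?thesis by simp
  qed
  have ck: "Ck_on k (\<lambda>z. frechet_derivative ?h (at z) w) S" for k w
    using sm unfolding smooth_on_def by (metis Ck_on.simps(2))
  show "smooth_on (\<lambda>(s, t). d_alpha h s t) S"
    unfolding smooth_on_def using A by (auto intro!: Ck_on_cong[OF S _ ck])
  show "smooth_on (\<lambda>(s, t). d_beta h s t) S"
    unfolding smooth_on_def using B by (auto intro!: Ck_on_cong[OF S _ ck])
qed

lemma smooth_partials:
  fixes h :: "real \<Rightarrow> real \<Rightarrow> real"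
  assumes S: "open S" and sm: "smooth_on (\<lambda>(s, t). h s t) S" and st: "(s, t) \<in> S"
  shows "((\<lambda>x. h x t) has_real_derivative d_alpha h s t) (at s)"
    and "((\<lambda>x. h s x) has_real_derivative d_beta h s t) (at t)"
proof -
  note hd = smooth_two_variables(1)[OF S sm st]
  have "((\<lambda>x. (x, t)) has_derivative (\<lambda>u. (u, 0))) (at s)"
    by (auto intro!: derivative_eq_intros)
  from has_derivative_compose[OF this hd]
  show "((\<lambda>x. h x t) has_real_derivative d_alpha h s t) (at s)"
    by (simp add: has_field_derivative_def mult_commute_abs)
  have "((\<lambda>x. (s, x)) has_derivative (\<lambda>u. (0, u))) (at t)"
    by (auto intro!: derivative_eq_intros)
  from has_derivative_compose[OF this hd]
  show "((\<lambda>x. h s x) has_real_derivative d_beta h s t) (at t)"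
    by (simp add: has_field_derivative_def mult_commute_abs)
qed

lemma mixed_partials:
  fixes h :: "real \<Rightarrow> real \<Rightarrow> real"
  assumes S: "open S" and sm: "smooth_on (\<lambda>(s, t). h s t) S" and st: "(s, t) \<in> S"
  shows "d_alpha (d_beta h) s t = d_beta (d_alpha h) s t"
proof (rule ccontr)
  let ?p = "\<lambda>(s, t). d_alpha (d_beta h) s t" and ?q = "\<lambda>(s, t). d_beta (d_alpha h) s t"
  assume ne: "\<not> ?thesis"
  define e where "e = \<bar>?p (s, t) - ?q (s, t)\<bar> / 2"
  have e: "e > 0" using ne by (simp add: e_def)
  note sa = smooth_two_variables(2)[OF S sm] and sb = smooth_two_variables(3)[OF S sm]
  have "continuous_on S ?p" "continuous_on S ?q"
    using smooth_two_variables(2)[OF S sb] smooth_two_variables(3)[OF S sa]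
    unfolding smooth_on_def by (metis Ck_on.simps(1))+
  then have "isCont ?p (s, t)" "isCont ?q (s, t)"
    using S st continuous_on_eq_continuous_at by blast+
  then have "eventually (\<lambda>z. dist (?p z) (?p (s, t)) < e) (nhds (s, t))"
    "eventually (\<lambda>z. dist (?q z) (?q (s, t)) < e) (nhds (s, t))"
    using e by (auto simp: continuous_at tendsto_iff eventually_at_filter elim!: eventually_mono)
  moreover have "eventually (\<lambda>z. z \<in> S) (nhds (s, t))"
    using S st by (rule eventually_nhds_in_open)
  ultimately have "eventually (\<lambda>z. z \<in> S \<and> dist (?p z) (?p (s, t)) < e
      \<and> dist (?q z) (?q (s, t)) < e) (nhds (s, t))"
    by eventually_elim auto
  then obtain d where d: "d > 0" and near: "\<And>z. dist z (s, t) < d \<Longrightarrow>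
      z \<in> S \<and> dist (?p z) (?p (s, t)) < e \<and> dist (?q z) (?q (s, t)) < e"
    unfolding eventually_nhds_metric by blast
  define r where "r = d / 3"
  have r: "r > 0" using d by (simp add: r_def)
  have box: "dist (x, y) (s, t) < d" if "s \<le> x" "x \<le> s + r" "t \<le> y" "y \<le> t + r" for x y
  proof -
    have "dist (x, y) (s, t) \<le> dist x s + dist y t"
      unfolding dist_Pair_Pair by (rule sqrt_sum_squares_le_sum) auto
    also have "\<dots> < d" using that d by (auto simp: dist_real_def r_def)
    finally show ?thesis .
  qed
  have inS: "(x, y) \<in> S" if "s \<le> x" "x \<le> s + r" "t \<le> y" "y \<le> t + r" for x y
    using near box[OF that] by blast
  have "\<exists>x>s. x < s + r \<and>
    (h (s + r) (t + r) - h (s + r) t) - (h s (t + r) - h s t) =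
      (s + r - s) * (d_alpha h x (t + r) - d_alpha h x t)"
    by (rule MVT2[of s "s + r" "\<lambda>x. h x (t + r) - h x t"])
      (use r in \<open>auto intro!: DERIV_diff smooth_partials(1)[OF S sm] inS\<close>)
  then obtain x where x: "s < x" "x < s + r"
    "(h (s + r) (t + r) - h (s + r) t) - (h s (t + r) - h s t) =
      r * (d_alpha h x (t + r) - d_alpha h x t)" by auto
  have "\<exists>y>t. y < t + r \<and>
    d_alpha h x (t + r) - d_alpha h x t = (t + r - t) * d_beta (d_alpha h) x y"
    by (rule MVT2[of t "t + r" "\<lambda>y. d_alpha h x y"])
      (use r x in \<open>auto intro!: smooth_partials(2)[OF S sa] inS\<close>)
  then obtain y where y: "t < y" "y < t + r"
    "d_alpha h x (t + r) - d_alpha h x t = r * d_beta (d_alpha h) x y" by auto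
  have "\<exists>y>t. y < t + r \<and>
    (h (s + r) (t + r) - h s (t + r)) - (h (s + r) t - h s t) =
      (t + r - t) * (d_beta h (s + r) y - d_beta h s y)"
    by (rule MVT2[of t "t + r" "\<lambda>y. h (s + r) y - h s y"])
      (use r in \<open>auto intro!: DERIV_diff smooth_partials(2)[OF S sm] inS\<close>)
  then obtain y' where y': "t < y'" "y' < t + r"
    "(h (s + r) (t + r) - h s (t + r)) - (h (s + r) t - h s t) =
      r * (d_beta h (s + r) y' - d_beta h s y')" by auto
  have "\<exists>x>s. x < s + r \<and>
    d_beta h (s + r) y' - d_beta h s y' = (s + r - s) * d_alpha (d_beta h) x y'"
    by (rule MVT2[of s "s + r" "\<lambda>x. d_beta h x y'"])
      (use r y' in \<open>auto intro!: smooth_partials(1)[OF S sb] inS\<close>)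
  then obtain x' where x': "s < x'" "x' < s + r"
    "d_beta h (s + r) y' - d_beta h s y' = r * d_alpha (d_beta h) x' y'" by auto
  have "r * (r * d_beta (d_alpha h) x y) = r * (r * d_alpha (d_beta h) x' y')"
    using x(3) unfolding y(3) using y'(3) unfolding x'(3) by linarith
  then have eq: "?q (x, y) = ?p (x', y')" using r by simp
  have "dist (?q (x, y)) (?q (s, t)) < e" "dist (?p (x', y')) (?p (s, t)) < e"
    using near box x y x' y' by (meson less_imp_le)+
  then have "\<bar>?p (s, t) - ?q (s, t)\<bar> < 2 * e"
    unfolding dist_real_def eq by linarith
  then show False by (simp add: e_def)
qed

lemma pderiv_at_cong:
  assumes "open S" "y \<in> S" "\<And>z. z \<in> S \<Longrightarrow> f z = g z"
  shows "pderiv_at i f y = pderiv_at i g y"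
proof -
  have "((\<lambda>t. y + t *\<^sub>R axis i 1) \<longlongrightarrow> y + 0 *\<^sub>R axis i (1::real)) (nhds 0)"
    by (intro tendsto_intros filterlim_ident)
  then have "eventually (\<lambda>t. y + t *\<^sub>R axis i 1 \<in> S) (nhds (0::real))"
    using assms(1,2) by (auto simp: tendsto_def)
  then have "eventually (\<lambda>t. f (y + t *\<^sub>R axis i 1) = g (y + t *\<^sub>R axis i 1)) (nhds 0)"
    by eventually_elim (use assms(3) in auto)
  then show ?thesis unfolding pderiv_at_def by (intro deriv_cong_ev) auto
qed

text \<open>The next lemmas are for \<open>g\<close> symmetric; \<open>g *v y\<close> has components \<open>Y\<^sup>i\<close>.\<close>

lemma alpha_eq: "alpha g y = sqrt (y \<bullet> (g *v y))"
  unfolding alpha_def inner_vec_def matrix_vector_mult_def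
  by (simp add: sum_distrib_left mult_ac)

lemma beta_eq: "beta v y = v \<bullet> y"
  unfolding beta_def inner_vec_def by simp

lemma matrix_vector_axis: "(g *v axis i 1) $ j = (g::real ^ 'n::finite ^ 'n) $ j $ i"
  by (simp add: matrix_vector_mult_basis column_def)

lemma Y_line:
  fixes g :: "real ^ 'n::finite ^ 'n"
  shows "((\<lambda>t. (g *v (y + t *\<^sub>R axis i 1)) $ j) has_real_derivative g $ j $ i) (at 0)"
proof -
  have "(\<lambda>t. (g *v (y + t *\<^sub>R axis i 1)) $ j) = (\<lambda>t. (g *v y) $ j + t * g $ j $ i)"
    by (simp add: matrix_vector_right_distrib matrix_vector_mult_scaleR matrix_vector_axis)
  then show ?thesis by (auto intro!: derivative_eq_intros)
qed

lemma beta_line: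
  fixes v :: "real ^ 'n::finite"
  shows "((\<lambda>t. beta v (y + t *\<^sub>R axis i 1)) has_real_derivative v $ i) (at 0)"
proof -
  have "(\<lambda>t. beta v (y + t *\<^sub>R axis i 1)) = (\<lambda>t. beta v y + t * v $ i)"
    by (simp add: beta_eq inner_add_right inner_axis)
  then show ?thesis by (auto intro!: derivative_eq_intros)
qed

lemma alpha_line:
  fixes g :: "real ^ 'n::finite ^ 'n"
  assumes sym: "transpose g = g" and pos: "alpha g y > 0"
  shows "((\<lambda>t. alpha g (y + t *\<^sub>R axis i 1)) has_real_derivative (g *v y) $ i / alpha g y) (at 0)"
proof -
  have 1: "y \<bullet> (g *v axis i 1) = (g *v y) $ i"
    using sym by (metis dot_lmul_matrix inner_axis mult.right_neutral inner_real_def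
        transpose_matrix_vector)
  have 2: "axis i 1 \<bullet> (g *v y) = (g *v y) $ i"
    by (simp add: inner_axis')
  have "(\<lambda>t. (y + t *\<^sub>R axis i 1) \<bullet> (g *v (y + t *\<^sub>R axis i 1))) =
      (\<lambda>t. y \<bullet> (g *v y) + 2 * t * (g *v y) $ i + t^2 * (axis i 1 \<bullet> (g *v axis i 1)))"
    using 1 2
    by (simp add: matrix_vector_right_distrib matrix_vector_mult_scaleR inner_add_left
        inner_add_right algebra_simps power2_eq_square)
  then have "((\<lambda>t. (y + t *\<^sub>R axis i 1) \<bullet> (g *v (y + t *\<^sub>R axis i 1)))
      has_real_derivative 2 * (g *v y) $ i) (at 0)"
    by (auto intro!: derivative_eq_intros)
  moreover have "0 < y \<bullet> (g *v y)" using pos by (simp add: alpha_eq)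
  ultimately show ?thesis
    unfolding alpha_eq by (auto intro!: derivative_eq_intros simp: field_simps)
qed

lemma chain_line:
  fixes g :: "real ^ 'n::finite ^ 'n"
  assumes D: "open D" and sm: "smooth_on (\<lambda>(s, t). k s t) D"
    and y: "(alpha g y, beta v y) \<in> D" and sym: "transpose g = g" and pos: "alpha g y > 0"
  shows "((\<lambda>t. k (alpha g (y + t *\<^sub>R axis i 1)) (beta v (y + t *\<^sub>R axis i 1)))
     has_real_derivative d_alpha k (alpha g y) (beta v y) * (g *v y) $ i / alpha g y +
       d_beta k (alpha g y) (beta v y) * v $ i) (at 0)"
proof -
  note hd = smooth_two_variables(1)[OF D sm y]
  have "((\<lambda>t. (alpha g (y + t *\<^sub>R axis i 1), beta v (y + t *\<^sub>R axis i 1))) has_derivative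
      (\<lambda>u. ((g *v y) $ i / alpha g y * u, v $ i * u))) (at 0)"
    using alpha_line[OF sym pos, of i] beta_line[of v y i]
    unfolding has_field_derivative_def by (rule has_derivative_Pair)
  from has_derivative_compose[OF this, of "\<lambda>(s, t). k s t"] hd show ?thesis
    unfolding has_field_derivative_def
    by (rule_tac has_derivative_eq_rhs) (auto simp: fun_eq_iff algebra_simps)
qed

lemma deriv_aux1:
  fixes A Y L B :: "real \<Rightarrow> real"
  assumes "(A has_real_derivative A') (at 0)" "(Y has_real_derivative Y') (at 0)"
    "(L has_real_derivative L') (at 0)" "(B has_real_derivative B') (at 0)" "L 0 > 0"
  shows "((\<lambda>t. A t * Y t / L t + B t * c) has_real_derivative
     A' * Y 0 / L 0 + A 0 * (Y' / L 0 - Y 0 * L' / (L 0)^2) + B' * c) (at 0)"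
proof -
  have ne: "L 0 \<noteq> 0" using assms(5) by simp
  show ?thesis
    by (rule DERIV_cong[OF DERIV_add[OF DERIV_divide[OF DERIV_mult[OF assms(1,2)] assms(3) ne]
          DERIV_cmult_right[OF assms(4)]]])
      (use ne in \<open>simp add: field_simps power2_eq_square\<close>)
qed

lemma deriv_aux2:
  fixes A Y L B C E X :: "real \<Rightarrow> real"
  assumes "(A has_real_derivative A') (at 0)" "(B has_real_derivative B') (at 0)"
    "(C has_real_derivative C') (at 0)" "(E has_real_derivative E') (at 0)"
    "(X has_real_derivative X') (at 0)" "(Y has_real_derivative Y') (at 0)"
    "(L has_real_derivative L') (at 0)" "L 0 > 0"
  shows "((\<lambda>t. (A t * X t / L t + B t * c) * Y t / L t + E t * (G / L t - X t * Y t / L t ^ 3)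
        + (B t * X t / L t + C t * c) * d) has_real_derivative
     (A' * X 0 / L 0 + A 0 * (X' / L 0 - X 0 * L' / (L 0)^2) + B' * c) * Y 0 / L 0
     + (A 0 * X 0 / L 0 + B 0 * c) * (Y' / L 0 - Y 0 * L' / (L 0)^2)
     + E' * (G / L 0 - X 0 * Y 0 / L 0 ^ 3)
     + E 0 * (- G * L' / (L 0)^2 - X' * Y 0 / L 0 ^ 3 - X 0 * Y' / L 0 ^ 3
              + 3 * X 0 * Y 0 * L' / L 0 ^ 4)
     + (B' * X 0 / L 0 + B 0 * (X' / L 0 - X 0 * L' / (L 0)^2) + C' * c) * d) (at 0)"
proof -
  have ne: "L 0 \<noteq> 0" using assms(8) by simp
  have q: "((\<lambda>t. Z t / L t) has_real_derivative Z' / L 0 - Z 0 * L' / (L 0)^2) (at 0)"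
    if "(Z has_real_derivative Z') (at 0)" for Z Z'
    by (rule derivative_eq_intros that assms(7) ne refl)+
      (use ne in \<open>simp add: field_simps power2_eq_square\<close>)
  have c3: "((\<lambda>t. G / L t - X t * Y t / L t ^ 3) has_real_derivative
      - G * L' / (L 0)^2 - X' * Y 0 / L 0 ^ 3 - X 0 * Y' / L 0 ^ 3
              + 3 * X 0 * Y 0 * L' / L 0 ^ 4) (at 0)"
  proof -
    have L3: "((\<lambda>t. L t ^ 3) has_real_derivative 3 * (L 0)^2 * L') (at 0)"
      by (auto intro!: derivative_eq_intros assms(7))
    have e: "(p * l^3 - q * (3 * l^2 * L')) / (l^3 * l^3) = p / l^3 - 3 * q * L' / l^4"
      if "l \<noteq> 0" for p q l :: real
    proof -
      have "q * (3 * l^2 * L') / (l^3 * l^3) = 3 * q * L' / l^4"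
        using that by (simp add: divide_simps eval_nat_numeral)
      moreover have "p * l^3 / (l^3 * l^3) = p / l^3"
        using that by (intro nonzero_mult_divide_mult_cancel_right) simp
      ultimately show ?thesis by (simp only: diff_divide_distrib)
    qed
    show ?thesis
      by (rule DERIV_cong[OF DERIV_diff[OF DERIV_divide[OF DERIV_const assms(7) ne]
            DERIV_divide[OF DERIV_mult[OF assms(5,6)] L3]]])
        (use ne in simp, simp only: e[OF ne], simp add: power2_eq_square add_divide_distrib mult_ac)
  qed
  have c1: "((\<lambda>t. A t * (X t / L t) + B t * c) has_real_derivative
      A' * (X 0 / L 0) + A 0 * (X' / L 0 - X 0 * L' / (L 0)^2) + B' * c) (at 0)"
    by (rule derivative_eq_intros assms q refl)+ simp
  have c2: "((\<lambda>t. B t * (X t / L t) + C t * c) has_real_derivative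
      B' * (X 0 / L 0) + B 0 * (X' / L 0 - X 0 * L' / (L 0)^2) + C' * c) (at 0)"
    by (rule derivative_eq_intros assms q refl)+ simp
  have "((\<lambda>t. (A t * (X t / L t) + B t * c) * (Y t / L t) + E t * (G / L t - X t * Y t / L t ^ 3)
        + (B t * (X t / L t) + C t * c) * d) has_real_derivative
     (A' * (X 0 / L 0) + A 0 * (X' / L 0 - X 0 * L' / (L 0)^2) + B' * c) * (Y 0 / L 0)
     + (A 0 * (X 0 / L 0) + B 0 * c) * (Y' / L 0 - Y 0 * L' / (L 0)^2)
     + E' * (G / L 0 - X 0 * Y 0 / L 0 ^ 3)
     + E 0 * (- G * L' / (L 0)^2 - X' * Y 0 / L 0 ^ 3 - X 0 * Y' / L 0 ^ 3
              + 3 * X 0 * Y 0 * L' / L 0 ^ 4)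
     + (B' * (X 0 / L 0) + B 0 * (X' / L 0 - X 0 * L' / (L 0)^2) + C' * c) * d) (at 0)"
    by (rule DERIV_cong[OF DERIV_add[OF DERIV_add[OF DERIV_mult[OF c1 q[OF assms(6)]]
            DERIV_mult[OF assms(4) c3]] DERIV_cmult_right[OF c2]]]) (simp add: algebra_simps)
  then show ?thesis by (simp add: times_divide_eq_right)
qed

lemma cartan_tensor_coefficients:
  fixes g :: "real ^ 'n::finite ^ 'n"
  assumes sym: "transpose g = g" and posdef: "\<And>y. y \<noteq> 0 \<Longrightarrow> 0 < y \<bullet> (g *v y)"
    and sm: "smooth_on (\<lambda>(s, t). H s t) {(s, t). 0 < s \<and> s < t}"
    and f: "\<And>z. z \<noteq> 0 \<Longrightarrow> 0 < beta v z \<Longrightarrow> alpha g z < beta v z \<Longrightarrow> f z = H (alpha g z) (beta v z)"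
    and y: "y \<noteq> 0" "0 < beta v y" "alpha g y < beta v y"
  defines "s \<equiv> alpha g y" and "t \<equiv> beta v y" and "Y \<equiv> g *v y"
  shows "- 2 * cartan_tensor f y i j k =
      r_m1 H s t * (v$i * v$j * v$k)
    + r_m2 H s t * (v$i * v$j * Y$k + v$j * v$k * Y$i + v$k * v$i * Y$j)
    + r_m3 H s t * (v$i * Y$j * Y$k + v$j * Y$k * Y$i + v$k * Y$i * Y$j)
    + r_m4 H s t * (Y$i * Y$j * Y$k)
    + 1 / (2 * s) * d_beta (d_alpha H) s t * (g$i$j * v$k + g$j$k * v$i + g$k$i * v$j)
    + 1 / (2 * s^2) * (d_alpha (d_alpha H) s t - 1 / s * d_alpha H s t) *
        (g$i$j * Y$k + g$j$k * Y$i + g$k$i * Y$j)"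
proof -
  define D where "D = {(s::real, t). 0 < s \<and> s < t}"
  have D: "open D"
  proof -
    have "D = {z. 0 < fst z} \<inter> {z. fst z < snd z}" by (auto simp: D_def)
    then show ?thesis by (auto intro!: open_Int open_Collect_less continuous_intros)
  qed
  define S where "S = {z. z \<noteq> 0 \<and> 0 < beta v z \<and> alpha g z < beta v z}"
  have S: "open S"
  proof -
    have "S = (- {0}) \<inter> {z. 0 < beta v z} \<inter> {z. alpha g z < beta v z}" by (auto simp: S_def)
    then show ?thesis unfolding alpha_eq beta_eq
      by (auto intro!: open_Int open_Collect_less continuous_intros matrix_vector_mult_linear_continuous_on)
  qed
  have yS: "y \<in> S" using y by (simp add: S_def)
  have pos: "alpha g z > 0" if "z \<in> S" for z
    using that posdef by (simp add: S_def alpha_eq)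
  have inD: "(alpha g z, beta v z) \<in> D" if "z \<in> S" for z
    using pos[OF that] that by (simp add: S_def D_def)
  have gs: "g $ i $ j = g $ j $ i" for i j using sym by (metis transpose_def vec_lambda_beta)
  note sm0 = sm[folded D_def]
  note sa = smooth_two_variables(2)[OF D sm0] and sb = smooth_two_variables(3)[OF D sm0]
  note saa = smooth_two_variables(2)[OF D sa] and sab = smooth_two_variables(3)[OF D sa]
  note sbb = smooth_two_variables(3)[OF D sb]
  note chain = chain_line[OF D _ inD sym pos]
  have m1: "d_alpha (d_beta H) s t = d_beta (d_alpha H) s t" if "(s, t) \<in> D" for s t
    by (rule mixed_partials[OF D sm0 that])
  have m2: "d_alpha (d_beta (d_alpha H)) s t = d_beta (d_alpha (d_alpha H)) s t" if "(s, t) \<in> D" for s t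
    by (rule mixed_partials[OF D sa that])
  have m3: "d_alpha (d_beta (d_beta H)) s t = d_beta (d_beta (d_alpha H)) s t" if st: "(s, t) \<in> D" for s t
  proof -
    have "eventually (\<lambda>x. (s, x) \<in> D) (nhds t)"
      using st eventually_nhds_in_open[of "{x. s < x}" t]
      by (auto simp: D_def open_Collect_less elim!: eventually_mono)
    then have "d_beta (d_alpha (d_beta H)) s t = d_beta (d_beta (d_alpha H)) s t"
      unfolding d_beta_def[of "d_alpha (d_beta H)"] d_beta_def[of "d_beta (d_alpha H)"]
      by (intro deriv_cong_ev) (auto elim!: eventually_mono simp: m1)
    then show ?thesis using mixed_partials[OF D sb st] by simp
  qed
  have p1: "pderiv_at j f z = d_alpha H (alpha g z) (beta v z) * (g *v z) $ j / alpha g z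
      + d_beta H (alpha g z) (beta v z) * v $ j" (is "_ = ?P1 j z") if z: "z \<in> S" for z j
  proof -
    have "pderiv_at j f z = pderiv_at j (\<lambda>z. H (alpha g z) (beta v z)) z"
      by (rule pderiv_at_cong[OF S z]) (auto simp: S_def f)
    then show ?thesis
      unfolding pderiv_at_def using DERIV_imp_deriv[OF chain[OF sm0 z z]] by simp
  qed
  define P2 where "P2 i j z =
      (d_alpha (d_alpha H) (alpha g z) (beta v z) * (g *v z) $ i / alpha g z
        + d_beta (d_alpha H) (alpha g z) (beta v z) * v $ i) * (g *v z) $ j / alpha g z
      + d_alpha H (alpha g z) (beta v z) *
        (g $ j $ i / alpha g z - (g *v z) $ i * (g *v z) $ j / alpha g z ^ 3)
      + (d_beta (d_alpha H) (alpha g z) (beta v z) * (g *v z) $ i / alpha g z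
        + d_beta (d_beta H) (alpha g z) (beta v z) * v $ i) * v $ j" for i j z
  have p2: "pderiv_at i (pderiv_at j f) z = P2 i j z" if z: "z \<in> S" for z i j
  proof -
    have "pderiv_at i (pderiv_at j f) z = pderiv_at i (?P1 j) z"
      by (rule pderiv_at_cong[OF S z]) (rule p1)
    also have "\<dots> = P2 i j z"
      unfolding pderiv_at_def P2_def
      by (rule DERIV_imp_deriv,
          rule DERIV_cong[OF deriv_aux1[OF chain[OF sa z z] Y_line alpha_line[OF sym pos[OF z]]
            chain[OF sb z z]]])
        (use pos[OF z] m1[OF inD[OF z]] in \<open>simp_all add: field_simps power2_eq_square power3_eq_cube\<close>)
    finally show ?thesis .
  qed
  have p3: "((\<lambda>u. P2 i j (y + u *\<^sub>R axis k 1)) has_real_derivative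
      2 * (r_m1 H s t * (v$i * v$j * v$k)
    + r_m2 H s t * (v$i * v$j * Y$k + v$j * v$k * Y$i + v$k * v$i * Y$j)
    + r_m3 H s t * (v$i * Y$j * Y$k + v$j * Y$k * Y$i + v$k * Y$i * Y$j)
    + r_m4 H s t * (Y$i * Y$j * Y$k)
    + 1 / (2 * s) * d_beta (d_alpha H) s t * (g$i$j * v$k + g$j$k * v$i + g$k$i * v$j)
    + 1 / (2 * s^2) * (d_alpha (d_alpha H) s t - 1 / s * d_alpha H s t) *
        (g$i$j * Y$k + g$j$k * Y$i + g$k$i * Y$j))) (at 0)"
  proof -
    have stD: "(s, t) \<in> D" using inD[OF yS] by (simp add: s_def t_def)
    note chain' = chain[OF _ yS yS, of _ k, folded s_def t_def Y_def]
    note d = deriv_aux2[OF chain'[OF saa] chain'[OF sab] chain'[OF sbb] chain'[OF sa]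
        Y_line[of g y k i] Y_line[of g y k j] alpha_line[OF sym pos[OF yS], of k], of "v $ i" "g $ j $ i" "v $ j"]
    have y0: "y + 0 *\<^sub>R axis k 1 = y" by simp
    have L0: "0 < alpha g (y + 0 *\<^sub>R axis k 1)" using pos[OF yS] by simp
    show ?thesis
      unfolding P2_def
      by (rule DERIV_cong[OF d[OF L0]],
          unfold y0, fold s_def t_def Y_def,
          unfold m2[OF stD] m3[OF stD] gs[of j i] gs[of j k] gs[of i k]
            r_m1_def r_m2_def r_m3_def r_m4_def divide_inverse inverse_mult_distrib
            power_inverse[symmetric])
        (simp add: algebra_simps eval_nat_numeral)
  qed
  have "pderiv_at k (\<lambda>z. fundamental_tensor f z $ i $ j) y = pderiv_at k (\<lambda>z. 1/2 * P2 i j z) y"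
    by (rule pderiv_at_cong[OF S yS]) (simp add: fundamental_tensor_def p2)
  also note pderiv_at_def
  finally have "pderiv_at k (\<lambda>z. fundamental_tensor f z $ i $ j) y =
    deriv (\<lambda>u. 1/2 * P2 i j (y + u *\<^sub>R axis k 1)) 0" .
  note this[unfolded DERIV_imp_deriv[OF DERIV_cmult[OF p3]]]
  moreover have "- 2 * (- 1/2 * x) = x" "1/2 * (2 * x) = x" for x :: real by simp_all
  ultimately show ?thesis
    unfolding cartan_tensor_def by (simp only:)
qed

end

theory Submission
  imports Defs
begin

text \<open>The invariants are fixed combinations of partial derivatives of \<open>H\<close>, so the
  claim is a calculation on the open wedge \<open>0 < s < t\<close>, where \<open>H\<close> is
  \<open>t^3 / (t - s)\<close>. Since \<open>t - s\<close> is linear in both variables, each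
  differentiation keeps the shape polynomial over a power of \<open>t - s\<close> and raises that
  power by one (\<open>DERIV_quotient_power\<close>); third derivatives thus have denominator
  \<open>(t - s)^4\<close>. Bringing the combinations to a common denominator gives the formulas
  (\<open>invariants\<close>). Points of U land in the wedge because positive definiteness of the
  metric makes \<alpha> positive.\<close>

lemma d_alpha_eqI:
  assumes "\<And>s t. 0 < s \<Longrightarrow> s < t \<Longrightarrow> h s t = g s t" "0 < s" "s < t"
    and "((\<lambda>x. g x t) has_real_derivative d) (at s)"
  shows "d_alpha h s t = d"
proof -
  \<comment> \<open>With \<open>t\<close> fixed, this open interval around \<open>s\<close> stays
    inside the wedge. A derivative depends only on values nearby, so closed forms known only on the
    wedge can be differentiated again.\<close>
  have "eventually (\<lambda>x. x \<in> {0<..<t}) (nhds s)"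
    using assms(2,3) by (intro eventually_nhds_in_open) auto
  then have "eventually (\<lambda>x. h x t = g x t) (nhds s)"
    by eventually_elim (simp add: assms(1))
  then have "d_alpha h s t = deriv (\<lambda>x. g x t) s"
    unfolding d_alpha_def by (intro deriv_cong_ev) auto
  then show ?thesis using DERIV_imp_deriv[OF assms(4)] by simp
qed

lemma d_beta_eqI:
  assumes "\<And>s t. 0 < s \<Longrightarrow> s < t \<Longrightarrow> h s t = g s t" "0 < s" "s < t"
    and "((\<lambda>x. g s x) has_real_derivative d) (at t)"
  shows "d_beta h s t = d"
proof -
  have "eventually (\<lambda>x. x \<in> {s<..}) (nhds t)"
    using assms(3) by (intro eventually_nhds_in_open) auto
  then have "eventually (\<lambda>x. h s x = g s x) (nhds t)"
    by eventually_elim (simp add: assms(1,2))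
  then have "d_beta h s t = deriv (\<lambda>x. g s x) t"
    unfolding d_beta_def by (intro deriv_cong_ev) auto
  then show ?thesis using DERIV_imp_deriv[OF assms(4)] by simp
qed

text \<open>The plain quotient rule would double the exponent; cancelling the common factor
  \<open>u x ^ (n - 1)\<close> leaves an increase of one. Stating \<open>d\<close> and
  \<open>m\<close> through equations lets the rule match any expected numerator and numeral
  exponent, leaving polynomial identities to check.\<close>

lemma DERIV_quotient_power:
  fixes P :: "real \<Rightarrow> real"
  assumes "(P has_real_derivative P') (at x)" "(u has_real_derivative u') (at x)" "u x \<noteq> 0"
    and "d = P' * u x - n * P x * u'" "m = Suc n"
  shows "((\<lambda>x. P x / u x ^ n) has_real_derivative d / u x ^ m) (at x)"
proof (rule DERIV_cong[OF DERIV_divide[OF assms(1) DERIV_power[OF assms(2), of n]]])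
  show "u x ^ n \<noteq> 0" using assms(3) by simp
  show "(P' * u x ^ n - P x * (of_nat n * (u' * u x ^ (n - Suc 0)))) / (u x ^ n * u x ^ n) = d / u x ^ m"
    \<comment> \<open>The case split removes the truncated subtraction
      \<open>n - Suc 0\<close>.\<close>
    using assms(3-5) by (cases n) (simp_all add: divide_simps, simp add: algebra_simps)
qed

context
  fixes H :: "real \<Rightarrow> real \<Rightarrow> real"
  assumes H: "\<And>s t. 0 < s \<Longrightarrow> s < t \<Longrightarrow> H s t = t^3 / (t - s)"
begin

text \<open>The exponent 1 makes the shape fit \<open>DERIV_quotient_power\<close>, so that every partial derivative is
  again a polynomial over a power of \<open>t - s\<close>.\<close>

lemma H_eq: "0 < s \<Longrightarrow> s < t \<Longrightarrow> H s t = t^3 / (t - s)^1"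
  by (simp add: H)

lemma H_alpha:
  assumes "0 < s" "s < t"
  shows "d_alpha H s t = t^3 / (t - s)^2"
  \<comment> \<open>The derivative of \<open>t - s\<close> is -1 in \<open>s\<close> and 1 in
    \<open>t\<close>; what remains is the identity for the new numerator. The other partial
    derivatives follow the same pattern.\<close>
  by (rule d_alpha_eqI[OF H_eq assms], assumption+, rule DERIV_quotient_power,
      (rule derivative_eq_intros refl)+)
    (use assms in \<open>simp_all add: algebra_simps eval_nat_numeral\<close>)

lemma H_beta:
  assumes "0 < s" "s < t"
  shows "d_beta H s t = (2 * t^3 - 3 * s * t^2) / (t - s)^2"
  by (rule d_beta_eqI[OF H_eq assms], assumption+, rule DERIV_quotient_power,
      (rule derivative_eq_intros refl)+)
    (use assms in \<open>simp_all add: algebra_simps eval_nat_numeral\<close>)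

lemma H_alpha_alpha:
  assumes "0 < s" "s < t"
  shows "d_alpha (d_alpha H) s t = 2 * t^3 / (t - s)^3"
  by (rule d_alpha_eqI[OF H_alpha assms], assumption+, rule DERIV_quotient_power,
      (rule derivative_eq_intros refl)+)
    (use assms in \<open>simp_all add: algebra_simps eval_nat_numeral\<close>)

lemma H_alpha_beta:
  assumes "0 < s" "s < t"
  shows "d_beta (d_alpha H) s t = (t^3 - 3 * s * t^2) / (t - s)^3"
  by (rule d_beta_eqI[OF H_alpha assms], assumption+, rule DERIV_quotient_power,
      (rule derivative_eq_intros refl)+)
    (use assms in \<open>simp_all add: algebra_simps eval_nat_numeral\<close>)

lemma H_beta_beta:
  assumes "0 < s" "s < t"
  shows "d_beta (d_beta H) s t = (2 * t^3 - 6 * s * t^2 + 6 * s^2 * t) / (t - s)^3"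
  by (rule d_beta_eqI[OF H_beta assms], assumption+, rule DERIV_quotient_power,
      (rule derivative_eq_intros refl)+)
    (use assms in \<open>simp_all add: algebra_simps eval_nat_numeral\<close>)

lemma H_alpha_alpha_alpha:
  assumes "0 < s" "s < t"
  shows "d_alpha (d_alpha (d_alpha H)) s t = 6 * t^3 / (t - s)^4"
  by (rule d_alpha_eqI[OF H_alpha_alpha assms], assumption+, rule DERIV_quotient_power,
      (rule derivative_eq_intros refl)+)
    (use assms in \<open>simp_all add: algebra_simps eval_nat_numeral\<close>)

lemma H_alpha_alpha_beta:
  assumes "0 < s" "s < t"
  shows "d_beta (d_alpha (d_alpha H)) s t = - 6 * s * t^2 / (t - s)^4"
  by (rule d_beta_eqI[OF H_alpha_alpha assms], assumption+, rule DERIV_quotient_power,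
      (rule derivative_eq_intros refl)+)
    (use assms in \<open>simp_all add: algebra_simps eval_nat_numeral\<close>)

lemma H_alpha_beta_beta:
  assumes "0 < s" "s < t"
  shows "d_beta (d_beta (d_alpha H)) s t = 6 * s^2 * t / (t - s)^4"
  by (rule d_beta_eqI[OF H_alpha_beta assms], assumption+, rule DERIV_quotient_power,
      (rule derivative_eq_intros refl)+)
    (use assms in \<open>simp_all add: algebra_simps eval_nat_numeral\<close>)

lemma H_beta_beta_beta:
  assumes "0 < s" "s < t"
  shows "d_beta (d_beta (d_beta H)) s t = - 6 * s^3 / (t - s)^4"
  by (rule d_beta_eqI[OF H_beta_beta assms], assumption+, rule DERIV_quotient_power,
      (rule derivative_eq_intros refl)+)
    (use assms in \<open>simp_all add: algebra_simps eval_nat_numeral\<close>)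

text \<open>The first two invariants are rescaled third derivatives. In the other two, lower-order
  terms are expanded to denominator \<open>(t - s)^4\<close>; for \<open>r_m4\<close> the numerator
  is \<open>t^3 * (6 * s^2 - 6 * s * (t - s) + 3 * (t - s)^2)\<close>.\<close>

lemma invariants:
  assumes "0 < s" "s < t"
  shows "r_m1 H s t = - 3 * s^3 / (t - s)^4"
    and "r_m2 H s t = 3 * s * t / (t - s)^4"
    and "r_m3 H s t = (4 * s * t^3 - t^4 - 9 * s^2 * t^2) / (2 * s^3 * (t - s)^4)"
    and "r_m4 H s t = (15 * s^2 * t^3 + 3 * t^5 - 12 * s * t^4) / (2 * s^5 * (t - s)^4)"
proof -
  note partials = H_alpha[OF assms] H_alpha_alpha[OF assms] H_alpha_beta[OF assms] H_alpha_alpha_alpha[OF assms] H_alpha_alpha_beta[OF assms]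
    H_alpha_beta_beta[OF assms] H_beta_beta_beta[OF assms]
  \<comment> \<open>In the variables \<open>s\<close> and \<open>u\<close> all denominators are
    monomials up to constants, so clearing them leaves a polynomial identity.\<close>
  define u where "u = t - s"
  have su: "s \<noteq> 0" "u \<noteq> 0" using assms by (simp_all add: u_def)
  have t: "t = u + s" by (simp add: u_def)
  show "r_m1 H s t = - 3 * s^3 / (t - s)^4"
    by (simp add: r_m1_def partials)
  show "r_m2 H s t = 3 * s * t / (t - s)^4"
    using su by (simp add: r_m2_def partials power2_eq_square)
  show "r_m3 H s t = (4 * s * t^3 - t^4 - 9 * s^2 * t^2) / (2 * s^3 * (t - s)^4)"
    unfolding r_m3_def partials using su
    by (simp add: t divide_simps) (simp add: algebra_simps eval_nat_numeral)
  show "r_m4 H s t = (15 * s^2 * t^3 + 3 * t^5 - 12 * s * t^4) / (2 * s^5 * (t - s)^4)"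
    unfolding r_m4_def partials using su
    by (simp add: t divide_simps) (simp add: algebra_simps eval_nat_numeral)
qed

end

theorem proposition5p4:
  fixes A :: "('m::{t2_space, second_countable_topology}, 'n::finite) chart set"
    and a :: "('m, 'n) chart \<Rightarrow> 'm \<Rightarrow> real ^ 'n ^ 'n"
    and b :: "('m, 'n) chart \<Rightarrow> 'm \<Rightarrow> real ^ 'n"
    and F :: "('m, 'n) chart \<Rightarrow> 'm \<Rightarrow> real ^ 'n \<Rightarrow> real"
    and H :: "real \<Rightarrow> real \<Rightarrow> real"
  assumes "smooth_manifold A"
    and "contravariant_riemannian_metric A a"
    and "vector_field A b"
    and "alpha_beta_cartan_space A (region_U a b) a b F H"
    and "\<And>s t. 0 < s \<Longrightarrow> s < t \<Longrightarrow> H s t = t^3 / (t - s)"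
  shows "\<forall>c\<in>A. \<forall>(p, y)\<in>region_U a b c.
    (let \<alpha> = alpha (a c p) y; \<beta> = beta (b c p) y in
      r_m1 H \<alpha> \<beta> = - 3 * \<alpha>^3 / (\<beta> - \<alpha>)^4 \<and>
      r_m2 H \<alpha> \<beta> = 3 * \<alpha> * \<beta> / (\<beta> - \<alpha>)^4 \<and>
      r_m3 H \<alpha> \<beta> = (4 * \<alpha> * \<beta>^3 - \<beta>^4 - 9 * \<alpha>^2 * \<beta>^2) / (2 * \<alpha>^3 * (\<beta> - \<alpha>)^4) \<and>
      r_m4 H \<alpha> \<beta> = (15 * \<alpha>^2 * \<beta>^3 + 3 * \<beta>^5 - 12 * \<alpha> * \<beta>^4) / (2 * \<alpha>^5 * (\<beta> - \<alpha>)^4))"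
proof (intro ballI case_prodI2)
  fix c z p y
  assume c: "c \<in> A" and z: "z \<in> region_U a b c" "z = (p, y)"
  define s t where "s = alpha (a c p) y" and "t = beta (b c p) y"
  \<comment> \<open>The region gives \<open>y \<noteq> 0\<close> but not \<alpha> > 0, which the
    wedge requires; positive definiteness supplies it.\<close>
  have "0 < y \<bullet> (a c p *v y)"
    using c z assms(2) unfolding contravariant_riemannian_metric_def region_U_def by blast
  then have "0 < s" by (simp add: s_def alpha_eq)
  moreover have "s < t" using z by (simp add: region_U_def s_def t_def)
  ultimately have "r_m1 H s t = - 3 * s^3 / (t - s)^4 \<and>
      r_m2 H s t = 3 * s * t / (t - s)^4 \<and>
      r_m3 H s t = (4 * s * t^3 - t^4 - 9 * s^2 * t^2) / (2 * s^3 * (t - s)^4) \<and>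
      r_m4 H s t = (15 * s^2 * t^3 + 3 * t^5 - 12 * s * t^4) / (2 * s^5 * (t - s)^4)"
    by (intro conjI invariants[OF assms(5)])
  then show "let \<alpha> = alpha (a c p) y; \<beta> = beta (b c p) y in
      r_m1 H \<alpha> \<beta> = - 3 * \<alpha>^3 / (\<beta> - \<alpha>)^4 \<and>
      r_m2 H \<alpha> \<beta> = 3 * \<alpha> * \<beta> / (\<beta> - \<alpha>)^4 \<and>
      r_m3 H \<alpha> \<beta> = (4 * \<alpha> * \<beta>^3 - \<beta>^4 - 9 * \<alpha>^2 * \<beta>^2) / (2 * \<alpha>^3 * (\<beta> - \<alpha>)^4) \<and>
      r_m4 H \<alpha> \<beta> = (15 * \<alpha>^2 * \<beta>^3 + 3 * \<beta>^5 - 12 * \<alpha> * \<beta>^4) / (2 * \<alpha>^5 * (\<beta> - \<alpha>)^4)"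
    unfolding Let_def s_def t_def .
qed

end
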